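(* Let $L$ be a Latin square of order $n \geq 1$ and let $a$ be an integer with $0\le 2a\le n$. Any $(n+a)$-cover of $L$ contains a partial transversal of deficit $2a$.
   Context: A Latin square of order $n$ is an $n\times n$ array on $n$ symbols in which each symbol occurs once in each row and each column; its set of entries is $E(L)=\{(i,j,L_{ij})\}$. A line is the set of all entries in a given row, in a given column, or with a given symbol. A cover is a subset of $E(L)$ meeting every line; an $(n+a)$-cover is a cover of size $n+a$. A partial transversal of deficit $d$ is an $(n-d)$-subset of $E(L)$ in which every line is represented at most once. *)

theory Defs
  imports Main
begin

text \<open>Rows and columns are indexed by \<open>{1..n}\<close>, the symbol set \<open>S\<close> is an arbitrary set of
  size \<open>n\<close>. Values of \<open>L\<close> outside \<open>{1..n} \<times> {1..n}\<close> are irrelevant.\<close>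

definition latin_square :: "nat \<Rightarrow> 's set \<Rightarrow> (nat \<Rightarrow> nat \<Rightarrow> 's) \<Rightarrow> bool" where
  "latin_square n S L \<longleftrightarrow>
     finite S \<and> card S = n \<and>
     (\<forall>i\<in>{1..n}. \<forall>j\<in>{1..n}. L i j \<in> S) \<and>
     (\<forall>i\<in>{1..n}. \<forall>s\<in>S. \<exists>!j. j \<in> {1..n} \<and> L i j = s) \<and>
     (\<forall>j\<in>{1..n}. \<forall>s\<in>S. \<exists>!i. i \<in> {1..n} \<and> L i j = s)"

definition entries :: "nat \<Rightarrow> (nat \<Rightarrow> nat \<Rightarrow> 's) \<Rightarrow> (nat \<times> nat \<times> 's) set" where
  "entries n L = {(i, j, L i j) | i j. i \<in> {1..n} \<and> j \<in> {1..n}}"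

definition row_line :: "nat \<Rightarrow> (nat \<Rightarrow> nat \<Rightarrow> 's) \<Rightarrow> nat \<Rightarrow> (nat \<times> nat \<times> 's) set" where
  "row_line n L r = {(i, j, s) \<in> entries n L. i = r}"

definition column_line :: "nat \<Rightarrow> (nat \<Rightarrow> nat \<Rightarrow> 's) \<Rightarrow> nat \<Rightarrow> (nat \<times> nat \<times> 's) set" where
  "column_line n L c = {(i, j, s) \<in> entries n L. j = c}"

definition symbol_line :: "nat \<Rightarrow> (nat \<Rightarrow> nat \<Rightarrow> 's) \<Rightarrow> 's \<Rightarrow> (nat \<times> nat \<times> 's) set" where
  "symbol_line n L t = {(i, j, s) \<in> entries n L. s = t}"

definition lines :: "nat \<Rightarrow> 's set \<Rightarrow> (nat \<Rightarrow> nat \<Rightarrow> 's) \<Rightarrow> (nat \<times> nat \<times> 's) set set" where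
  "lines n S L = row_line n L ` {1..n} \<union> column_line n L ` {1..n} \<union> symbol_line n L ` S"

definition cover :: "nat \<Rightarrow> 's set \<Rightarrow> (nat \<Rightarrow> nat \<Rightarrow> 's) \<Rightarrow> (nat \<times> nat \<times> 's) set \<Rightarrow> bool" where
  "cover n S L C \<longleftrightarrow> C \<subseteq> entries n L \<and> (\<forall>l\<in>lines n S L. C \<inter> l \<noteq> {})"

text \<open>The condition \<open>d \<le> n\<close> rules out truncation in the natural-number difference \<open>n - d\<close>.\<close>

definition partial_transversal ::
  "nat \<Rightarrow> 's set \<Rightarrow> (nat \<Rightarrow> nat \<Rightarrow> 's) \<Rightarrow> nat \<Rightarrow> (nat \<times> nat \<times> 's) set \<Rightarrow> bool" where
  "partial_transversal n S L d T \<longleftrightarrow>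
     T \<subseteq> entries n L \<and> d \<le> n \<and> card T = n - d \<and> (\<forall>l\<in>lines n S L. card (T \<inter> l) \<le> 1)"

end

theory Submission
  imports Defs
begin

text \<open>Projecting an \<open>(n+a)\<close>-cover onto its rows is onto a set of size \<open>n\<close>, so discarding \<open>a\<close>
  entries makes this projection injective. The same holds for columns and symbols, and the entries
  discarded for none of the three reasons number at least \<open>n + a - 3a = n - 2a\<close>.\<close>

text \<open>Keep one preimage in \<open>C\<close> for each element of \<open>A\<close>; the entries
  not kept form \<open>D\<close>, and the cardinality hypothesis makes their number exactly
  \<open>a\<close>.\<close>

lemma inj_on_subset_removing:
  assumes "finite C" and "f ` C = A" and "card C = card A + a"
  obtains D where "D \<subseteq> C" "card D = a" "inj_on f (C - D)"
proof -
  obtain R where R: "R \<subseteq> C" "inj_on f R" "A = f ` R"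
    using subset_image_inj[of A f C] assms(2) by auto
  have "card R = card A"
    using R by (simp add: card_image)
  with R assms(1,3) have "card (C - R) = a"
    by (simp add: card_Diff_subset finite_subset)
  moreover have "C - (C - R) = R"
    using R(1) by blast
  ultimately show thesis
    using R(2) that[of "C - R"] by auto
qed

text \<open>Each line lies in a fibre of one of the three coordinate projections, so this turns
  injectivity of a projection on \<open>T\<close> into the condition that \<open>T\<close>
  represents a line at most once.\<close>

lemma card_Int_le_1:
  assumes "inj_on f T" and "\<And>x. x \<in> l \<Longrightarrow> f x = c"
  shows "card (T \<inter> l) \<le> 1"
proof -
  have "inj_on f (T \<inter> l)"
    using assms(1) by (rule inj_on_subset) blast
  moreover have "f ` (T \<inter> l) \<subseteq> {c}"
    using assms(2) by blast
  ultimately show ?thesis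
    using card_inj_on_le[of f "T \<inter> l" "{c}"] by simp
qed

text \<open>Meeting every line gives surjectivity; containment in \<open>entries n L\<close> keeps
  the images within the index ranges.\<close>

lemma cover_projections:
  assumes L: "latin_square n S L" and C: "cover n S L C"
  shows "fst ` C = {1..n}" "(fst \<circ> snd) ` C = {1..n}" "(snd \<circ> snd) ` C = S"
proof -
  have sub: "C \<subseteq> entries n L" and meet: "\<And>l. l \<in> lines n S L \<Longrightarrow> \<exists>x. x \<in> C \<and> x \<in> l"
    using C unfolding cover_def by blast+
  have "\<exists>x\<in>C. fst x = r" if "r \<in> {1..n}" for r
    using meet[of "row_line n L r"] that by (auto simp: lines_def row_line_def intro: rev_bexI)
  with sub show "fst ` C = {1..n}"
    by (fastforce simp: entries_def image_iff)
  have "\<exists>x\<in>C. fst (snd x) = c" if "c \<in> {1..n}" for c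
    using meet[of "column_line n L c"] that by (auto simp: lines_def column_line_def intro: rev_bexI)
  with sub show "(fst \<circ> snd) ` C = {1..n}"
    by (fastforce simp: entries_def image_iff)
  have "\<exists>x\<in>C. snd (snd x) = t" if "t \<in> S" for t
    using meet[of "symbol_line n L t"] that by (auto simp: lines_def symbol_line_def intro: rev_bexI)
  \<comment> \<open>The definition of \<open>entries\<close> bounds rows and columns; that symbols
    stay in \<open>S\<close> comes from \<open>latin_square\<close>.\<close>
  moreover have "snd (snd x) \<in> S" if "x \<in> C" for x
    using L sub that by (auto simp: latin_square_def entries_def)
  ultimately show "(snd \<circ> snd) ` C = S"
    by (fastforce simp: image_iff)
qed

theorem theorem2p3:
  fixes n a :: nat and S :: "'s set" and L :: "nat \<Rightarrow> nat \<Rightarrow> 's"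
    and C :: "(nat \<times> nat \<times> 's) set"
  assumes "n \<ge> 1"
    and "2 * a \<le> n"
    and "latin_square n S L"
    and "cover n S L C"
    and "card C = n + a"
  shows "\<exists>T\<subseteq>C. partial_transversal n S L (2 * a) T"
proof -
  note proj = cover_projections[OF assms(3,4)]
  \<comment> \<open>An infinite set has \<open>card\<close> equal to 0, whereas \<open>n + a\<close>
    is positive.\<close>
  have fin: "finite C"
    using assms(1,5) by (simp add: card_ge_0_finite)
  have cS: "card S = n"
    using assms(3) by (simp add: latin_square_def)
  obtain D1 where D1: "D1 \<subseteq> C" "card D1 = a" "inj_on fst (C - D1)"
    using inj_on_subset_removing[OF fin proj(1)] assms(5) by auto
  obtain D2 where D2: "D2 \<subseteq> C" "card D2 = a" "inj_on (fst \<circ> snd) (C - D2)"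
    using inj_on_subset_removing[OF fin proj(2)] assms(5) by auto
  obtain D3 where D3: "D3 \<subseteq> C" "card D3 = a" "inj_on (snd \<circ> snd) (C - D3)"
    using inj_on_subset_removing[OF fin proj(3)] assms(5) cS by auto
  have "card (D1 \<union> D2 \<union> D3) \<le> 3 * a"
    using card_Un_le[of "D1 \<union> D2" D3] card_Un_le[of D1 D2] D1(2) D2(2) D3(2) by linarith
  \<comment> \<open>The removed sets may overlap, so only a lower bound is available.\<close>
  then have "n - 2 * a \<le> card (C - (D1 \<union> D2 \<union> D3))"
    using diff_card_le_card_Diff[of "D1 \<union> D2 \<union> D3" C] D1(1) D2(1) D3(1) fin assms(5)
    by (simp add: finite_subset)
  \<comment> \<open>Trimming to the exact size is harmless, since injectivity passes to
    subsets.\<close>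
  then obtain T where T: "T \<subseteq> C - (D1 \<union> D2 \<union> D3)" "card T = n - 2 * a"
    by (rule obtain_subset_with_card_n)
  have inj: "inj_on fst T" "inj_on (fst \<circ> snd) T" "inj_on (snd \<circ> snd) T"
    using T(1) by (auto intro: inj_on_subset[OF D1(3)] inj_on_subset[OF D2(3)] inj_on_subset[OF D3(3)])
  have "card (T \<inter> row_line n L r) \<le> 1" for r
    by (rule card_Int_le_1[OF inj(1), of _ r]) (auto simp: row_line_def)
  moreover have "card (T \<inter> column_line n L c) \<le> 1" for c
    by (rule card_Int_le_1[OF inj(2), of _ c]) (auto simp: column_line_def)
  moreover have "card (T \<inter> symbol_line n L t) \<le> 1" for t
    by (rule card_Int_le_1[OF inj(3), of _ t]) (auto simp: symbol_line_def)
  ultimately have "\<forall>l\<in>lines n S L. card (T \<inter> l) \<le> 1"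
    unfolding lines_def by blast
  moreover have "T \<subseteq> entries n L"
    using T(1) assms(4) by (auto simp: cover_def)
  ultimately have "partial_transversal n S L (2 * a) T"
    using T(2) assms(2) by (simp add: partial_transversal_def)
  with T(1) show ?thesis
    by blast
qed

end
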